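(* Let $B$ be a topological space and let $p:X\to B$, $q:Y\to B$ and $f:X\to Y$ be proper maps with $qf=p$. Let $\{B_\alpha\}_{\alpha\in A}$ be a closed p-numerable covering of $B$. Suppose that for each $\alpha\in A$ the restriction $f_\alpha:p^{-1}(B_\alpha)\to q^{-1}(B_\alpha)$ of $f$ (where $p^{-1}(B_\alpha)$ and $q^{-1}(B_\alpha)$ are regarded as spaces over $B_\alpha$ through the restrictions $p_\alpha$ and $q_\alpha$ of $p$ and $q$) is a proper homotopy equivalence over $B_\alpha$. Then $f:X\to Y$ is a proper homotopy equivalence over $B$.
   Context: A proper map is a continuous map $f:X\to Y$ such that $f^{-1}(K)$ is a compact subset of $X$ for every closed compact subset $K$ of $Y$. $I=[0,1]$. A space over $B$ is a proper map $p:X\to B$; a proper map over $B$ from $p:X\to B$ to $q:Y\to B$ is a proper map $f:X\to Y$ with $qf=p$. Two proper maps $f,g:X\to Y$ over $B$ are properly homotopic over $B$ if there is a proper map $H:X\times I\to Y$ with $H(x,0)=f(x)$, $H(x,1)=g(x)$ and $qH(x,t)=p(x)$ for all $x\in X$, $t\in I$. A proper map $f:X\to Y$ over $B$ is a proper homotopy equivalence over $B$ if there is a proper map $f':Y\to X$ over $B$ such that $f'f$ and $ff'$ are properly homotopic over $B$ to the respective identities. The Alexandroff compactification of a space $B$ is $B^+=B\cup\{\infty\}$ (with $\infty\notin B$), whose open sets are the open sets of $B$ together with the sets $(B\setminus K)\cup\{\infty\}$ with $K$ a closed compact subset of $B$. A (not necessarily open) covering $\mathcal{U}$ of a topological space $Z$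 is numerable if it admits a refinement by a partition of unity, i.e. there is a locally finite partition of unity $\{\pi_\gamma\}_\gamma$ on $Z$ such that each set $\pi_\gamma^{-1}((0,1])$ is contained in some member of $\mathcal{U}$. A covering $\{B_\alpha\}_{\alpha\in A}$ of $B$ is p-numerable (proper numerable) if $\{B_\alpha\cup\{\infty\}\}_{\alpha\in A}$ is a numerable covering of $B^+$; it is closed if each $B_\alpha$ is a closed subset of $B$. *)

theory Defs
  imports "HOL-Analysis.Analysis"
begin

text \<open>Not the library's \<^const>\<open>proper_map\<close>, which asks for a closed map with compact fibres
  and does not include continuity.\<close>

definition proper_cont_map :: "'x topology \<Rightarrow> 'y topology \<Rightarrow> ('x \<Rightarrow> 'y) \<Rightarrow> bool" where
  "proper_cont_map X Y f \<longleftrightarrow>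
     continuous_map X Y f \<and>
     (\<forall>K. compactin Y K \<and> closedin Y K \<longrightarrow> compactin X {x \<in> topspace X. f x \<in> K})"

abbreviation unit_interval :: "real topology" where
  "unit_interval \<equiv> top_of_set {0..1}"

definition proper_map_over ::
  "'b topology \<Rightarrow> 'x topology \<Rightarrow> ('x \<Rightarrow> 'b) \<Rightarrow> 'y topology \<Rightarrow> ('y \<Rightarrow> 'b) \<Rightarrow> ('x \<Rightarrow> 'y) \<Rightarrow> bool" where
  "proper_map_over B X p Y q f \<longleftrightarrow>
     proper_cont_map X B p \<and> proper_cont_map Y B q \<and>
     proper_cont_map X Y f \<and> (\<forall>x \<in> topspace X. q (f x) = p x)"

definition properly_homotopic_over ::
  "'b topology \<Rightarrow> 'x topology \<Rightarrow> ('x \<Rightarrow> 'b) \<Rightarrow> 'y topology \<Rightarrow> ('y \<Rightarrow> 'b)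
     \<Rightarrow> ('x \<Rightarrow> 'y) \<Rightarrow> ('x \<Rightarrow> 'y) \<Rightarrow> bool" where
  "properly_homotopic_over B X p Y q f g \<longleftrightarrow>
     proper_map_over B X p Y q f \<and> proper_map_over B X p Y q g \<and>
     (\<exists>H. proper_cont_map (prod_topology X unit_interval) Y H \<and>
          (\<forall>x \<in> topspace X. H (x, 0) = f x \<and> H (x, 1) = g x) \<and>
          (\<forall>x \<in> topspace X. \<forall>t \<in> {0..1}. q (H (x, t)) = p x))"

definition proper_homotopy_equivalence_over ::
  "'b topology \<Rightarrow> 'x topology \<Rightarrow> ('x \<Rightarrow> 'b) \<Rightarrow> 'y topology \<Rightarrow> ('y \<Rightarrow> 'b) \<Rightarrow> ('x \<Rightarrow> 'y) \<Rightarrow> bool" where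
  "proper_homotopy_equivalence_over B X p Y q f \<longleftrightarrow>
     proper_map_over B X p Y q f \<and>
     (\<exists>f'. proper_map_over B Y q X p f' \<and>
           properly_homotopic_over B X p X p (f' \<circ> f) id \<and>
           properly_homotopic_over B Y q Y q (f \<circ> f') id)"

text \<open>Local finiteness is that of the indexed family (not of the set of its members); it makes
  the sum below a finite one.\<close>

definition locally_finite_partition_of_unity ::
  "'z topology \<Rightarrow> 'i set \<Rightarrow> ('i \<Rightarrow> 'z \<Rightarrow> real) \<Rightarrow> bool" where
  "locally_finite_partition_of_unity Z \<Gamma> \<pi> \<longleftrightarrow>
     (\<forall>\<gamma> \<in> \<Gamma>. continuous_map Z unit_interval (\<pi> \<gamma>)) \<and>
     (\<forall>z \<in> topspace Z. \<exists>W. openin Z W \<and> z \<in> W \<and> finite {\<gamma> \<in> \<Gamma>. \<exists>w \<in> W. \<pi> \<gamma> w \<noteq> 0}) \<and>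
     (\<forall>z \<in> topspace Z. (\<Sum>\<gamma> | \<gamma> \<in> \<Gamma> \<and> \<pi> \<gamma> z \<noteq> 0. \<pi> \<gamma> z) = 1)"

text \<open>HOL cannot quantify existentially over the type of indices of the partition of unity, so
  that type is a parameter. In a theorem with the hypothesis \<open>numerable_covering TYPE('i) Z \<U>\<close>
  for a type variable \<open>'i\<close> not occurring elsewhere, index sets of every type are allowed.\<close>

definition numerable_covering :: "'i itself \<Rightarrow> 'z topology \<Rightarrow> 'z set set \<Rightarrow> bool" where
  "numerable_covering (_ :: 'i itself) Z \<U> \<longleftrightarrow>
     \<Union>\<U> = topspace Z \<and>
     (\<exists>(\<Gamma> :: 'i set) \<pi>. locally_finite_partition_of_unity Z \<Gamma> \<pi> \<and>
        (\<forall>\<gamma> \<in> \<Gamma>. \<exists>U \<in> \<U>. {z \<in> topspace Z. \<pi> \<gamma> z \<in> {0<..1}} \<subseteq> U))"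

text \<open>In \<^const>\<open>Alexandroff_compactification\<close>, \<^const>\<open>None\<close> is the point at infinity and
  \<^const>\<open>Some\<close> embeds the space.\<close>

definition p_numerable_covering ::
  "'i itself \<Rightarrow> 'b topology \<Rightarrow> 'a set \<Rightarrow> ('a \<Rightarrow> 'b set) \<Rightarrow> bool" where
  "p_numerable_covering I B A C \<longleftrightarrow>
     (\<Union>\<alpha>\<in>A. C \<alpha>) = topspace B \<and>
     numerable_covering I (Alexandroff_compactification B) ((\<lambda>\<alpha>. insert None (Some ` C \<alpha>)) ` A)"

abbreviation preimage_space :: "'x topology \<Rightarrow> ('x \<Rightarrow> 'b) \<Rightarrow> 'b set \<Rightarrow> 'x topology" where
  "preimage_space X p S \<equiv> subtopology X {x \<in> topspace X. p x \<in> S}"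

end

theory Submission
  imports Defs
begin

text \<open>
  The Alexandroff compactification of any space is compact, so a locally finite partition of unity
  on it has only finitely many nonzero members (\<open>finite_partition_of_unity_compact\<close>). Hence it is enough
  to glue over finitely many parts of the base, and this reduces by induction
  (\<open>fib_equiv_on_sum_ge\<close>) to two parts \<open>{\<tau> \<le> 1}\<close> and \<open>{\<tau> \<ge> 0}\<close> given by one real function \<open>\<tau>\<close>
  on the base (\<open>fib_equiv_union\<close>). Finiteness also takes care of properness: preimages of compact
  sets are finite unions of compact pieces, and reparametrizing the time of a proper homotopy by a
  continuous function leaves it proper because the unit interval is compact.

  For two parts, homotopy inverses of \<open>f\<close> over each are homotopic over the band \<open>{0 \<le> \<tau> \<le> 1}\<close>,
  and with \<open>\<tau>\<close> as time parameter such a homotopy interpolates between them. The result is a map \<open>g\<close>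
  over the whole base such that \<open>g f\<close> and \<open>f g\<close> are homotopic to the identity over each of the two
  parts separately. It then suffices that a self-map \<open>u\<close> with this property is an equivalence
  (\<open>fib_equiv_locally_homotopic_id\<close>). The two homotopies from \<open>u\<close> to the identity differ over the
  band by a loop \<open>K\<close> at the identity, and \<open>u\<close> is homotopic to the map that is the identity outside
  the band and \<open>K\<close> at time \<open>\<tau>\<close> inside it. The same construction with the reversed loop is an
  inverse of this map (\<open>twist_reverse\<close>). Splitting the argument in this way avoids path fibrations, whose
  projections are not proper, and any choice of compatible higher homotopies.
\<close>

section \<open>Proper continuous maps\<close>

lemma proper_cont_map_continuous: "proper_cont_map X Y f \<Longrightarrow> continuous_map X Y f"
  by (simp add: proper_cont_map_def)

lemma proper_cont_map_preimage:
  "\<lbrakk>proper_cont_map X Y f; compactin Y K; closedin Y K\<rbrakk> \<Longrightarrow> compactin X {x \<in> topspace X. f x \<in> K}"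
  by (simp add: proper_cont_map_def)

lemma proper_cont_map_eq:
  assumes "proper_cont_map X Y f" "\<And>x. x \<in> topspace X \<Longrightarrow> g x = f x"
  shows "proper_cont_map X Y g"
proof -
  have "{x \<in> topspace X. g x \<in> K} = {x \<in> topspace X. f x \<in> K}" for K
    using assms(2) by auto
  then show ?thesis
    using assms continuous_map_eq[of X Y f g] by (simp add: proper_cont_map_def)
qed

lemma proper_cont_map_compose:
  assumes f: "proper_cont_map X Y f" and g: "proper_cont_map Y Z g"
  shows "proper_cont_map X Z (\<lambda>x. g (f x))"
  unfolding proper_cont_map_def
proof (intro conjI allI impI)
  show "continuous_map X Z (\<lambda>x. g (f x))"
    using continuous_map_compose[OF proper_cont_map_continuous[OF f] proper_cont_map_continuous[OF g]]
    by (simp add: o_def)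
  fix K assume K: "compactin Z K \<and> closedin Z K"
  let ?L = "{y \<in> topspace Y. g y \<in> K}"
  have "compactin Y ?L" "closedin Y ?L"
    using K g by (auto simp: proper_cont_map_def intro: closedin_continuous_map_preimage)
  moreover have "{x \<in> topspace X. g (f x) \<in> K} = {x \<in> topspace X. f x \<in> ?L}"
    using continuous_map_funspace[OF proper_cont_map_continuous[OF f]] by auto
  ultimately show "compactin X {x \<in> topspace X. g (f x) \<in> K}"
    using proper_cont_map_preimage[OF f, of ?L] by simp
qed

lemma proper_cont_map_from_closed_subtopology:
  assumes f: "proper_cont_map X Y f" and S: "closedin X S"
  shows "proper_cont_map (subtopology X S) Y f"
  unfolding proper_cont_map_def
proof (intro conjI allI impI)
  show "continuous_map (subtopology X S) Y f"
    using f by (simp add: proper_cont_map_continuous continuous_map_from_subtopology)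
  fix K assume K: "compactin Y K \<and> closedin Y K"
  have eq: "{x \<in> topspace (subtopology X S). f x \<in> K} = S \<inter> {x \<in> topspace X. f x \<in> K}"
    by auto
  show "compactin (subtopology X S) {x \<in> topspace (subtopology X S). f x \<in> K}"
    unfolding eq compactin_subtopology
    using closed_Int_compactin[OF S proper_cont_map_preimage[OF f]] K by blast
qed

lemma proper_cont_map_into_closed_subtopology:
  assumes f: "proper_cont_map X Y f" and S: "closedin Y S"
    and im: "\<And>x. x \<in> topspace X \<Longrightarrow> f x \<in> S"
  shows "proper_cont_map X (subtopology Y S) f"
  unfolding proper_cont_map_def
proof (intro conjI allI impI)
  show "continuous_map X (subtopology Y S) f"
    using f im by (auto simp: continuous_map_in_subtopology proper_cont_map_continuous)
  fix K assume K: "compactin (subtopology Y S) K \<and> closedin (subtopology Y S) K"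
  then have "compactin Y K" "closedin Y K"
    using S closedin_trans_full by (auto simp: compactin_subtopology)
  then show "compactin X {x \<in> topspace X. f x \<in> K}"
    using proper_cont_map_preimage[OF f] by simp
qed

text \<open>Two pieces, hence finitely many, keep the preimages of compact sets compact; with a
  locally finite family of infinitely many pieces only continuity would survive.\<close>

lemma proper_cont_map_glue:
  assumes S: "closedin X S" and T: "closedin X T" and cover: "topspace X \<subseteq> S \<union> T"
    and fS: "proper_cont_map (subtopology X S) Y f"
    and fT: "proper_cont_map (subtopology X T) Y f"
  shows "proper_cont_map X Y f"
proof -
  have eq: "{x \<in> topspace X. f x \<in> K} =
      {x \<in> topspace (subtopology X S). f x \<in> K} \<union> {x \<in> topspace (subtopology X T). f x \<in> K}" for K
    using cover by auto
  have "continuous_map X Y f"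
    unfolding continuous_map_closedin
  proof (intro conjI allI impI)
    show "f \<in> topspace X \<rightarrow> topspace Y"
      using cover continuous_map_funspace[OF proper_cont_map_continuous[OF fS]]
        continuous_map_funspace[OF proper_cont_map_continuous[OF fT]] by (auto simp: Pi_iff)
    fix C assume C: "closedin Y C"
    have "closedin X {x \<in> topspace (subtopology X U). f x \<in> C}"
      if "closedin X U" "proper_cont_map (subtopology X U) Y f" for U
      using closedin_trans_full[OF closedin_continuous_map_preimage
          [OF proper_cont_map_continuous[OF that(2)] C] that(1)] .
    then show "closedin X {x \<in> topspace X. f x \<in> C}"
      unfolding eq using S T fS fT by (intro closedin_Un) auto
  qed
  moreover have "compactin X {x \<in> topspace X. f x \<in> K}" if "compactin Y K" "closedin Y K" for K
    unfolding eq using proper_cont_map_preimage[OF fS that] proper_cont_map_preimage[OF fT that]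
    by (intro compactin_Un) (simp_all add: compactin_subtopology)
  ultimately show ?thesis
    by (simp add: proper_cont_map_def)
qed

lemma proper_cont_map_fst_compact:
  assumes "compact_space T"
  shows "proper_cont_map (prod_topology X T) X fst"
  unfolding proper_cont_map_def
proof (intro conjI allI impI)
  show "continuous_map (prod_topology X T) X fst"
    by (rule continuous_map_fst)
  fix K assume K: "compactin X K \<and> closedin X K"
  have "{x \<in> topspace (prod_topology X T). fst x \<in> K} = K \<times> topspace T"
    using K closedin_subset by auto
  then show "compactin (prod_topology X T) {x \<in> topspace (prod_topology X T). fst x \<in> K}"
    using K assms by (simp add: compactin_Times compact_space_def)
qed

text \<open>The projection along the compact factor is closed, so it takes a closed compact set \<open>K\<close>
  to a closed compact set, and the preimage of \<open>K\<close> is a closed subset of a compact one. This is why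
  changing the time parameter of a proper homotopy, even depending on the point, never destroys
  properness.\<close>

lemma proper_cont_map_pair_compact:
  assumes k: "proper_cont_map Z X k" and \<sigma>: "continuous_map Z T \<sigma>" and T: "compact_space T"
  shows "proper_cont_map Z (prod_topology X T) (\<lambda>z. (k z, \<sigma> z))"
  unfolding proper_cont_map_def
proof (intro conjI allI impI)
  show cont: "continuous_map Z (prod_topology X T) (\<lambda>z. (k z, \<sigma> z))"
    using k \<sigma> by (auto intro: continuous_map_pairedI proper_cont_map_continuous)
  fix K assume K: "compactin (prod_topology X T) K \<and> closedin (prod_topology X T) K"
  have "compactin X (fst ` K)"
    using K image_compactin continuous_map_fst by blast
  moreover have "closedin X (fst ` K)"
    using K Abstract_Topological_Spaces.closed_map_fst[OF T, of X] by (simp add: closed_map_def)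
  ultimately have "compactin Z {z \<in> topspace Z. k z \<in> fst ` K}"
    using proper_cont_map_preimage[OF k] by blast
  moreover have "closedin Z {z \<in> topspace Z. (k z, \<sigma> z) \<in> K}"
    using closedin_continuous_map_preimage[OF cont] K by blast
  moreover have "{z \<in> topspace Z. (k z, \<sigma> z) \<in> K} \<subseteq> {z \<in> topspace Z. k z \<in> fst ` K}"
    by force
  ultimately show "compactin Z {z \<in> topspace Z. (k z, \<sigma> z) \<in> K}"
    using closed_compactin by blast
qed

section \<open>Fibrewise proper maps and homotopies\<close>

text \<open>The base enters the arguments only through the values of \<open>p\<close> and \<open>q\<close> and through
  real functions composed with them. Keeping the properness of \<open>p\<close> and \<open>q\<close> out of this notion makes it
  apply without change to cylinders and to preimages of parts of the base.\<close>

definition fib_map ::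
  "'x topology \<Rightarrow> ('x \<Rightarrow> 'b) \<Rightarrow> 'y topology \<Rightarrow> ('y \<Rightarrow> 'b) \<Rightarrow> ('x \<Rightarrow> 'y) \<Rightarrow> bool" where
  "fib_map X p Y q f \<longleftrightarrow> proper_cont_map X Y f \<and> (\<forall>x \<in> topspace X. q (f x) = p x)"

abbreviation cyl :: "'x topology \<Rightarrow> ('x \<times> real) topology" where
  "cyl X \<equiv> prod_topology X unit_interval"

definition fib_homotopic ::
  "'x topology \<Rightarrow> ('x \<Rightarrow> 'b) \<Rightarrow> 'y topology \<Rightarrow> ('y \<Rightarrow> 'b) \<Rightarrow> ('x \<Rightarrow> 'y) \<Rightarrow> ('x \<Rightarrow> 'y) \<Rightarrow> bool" where
  "fib_homotopic X p Y q f g \<longleftrightarrow>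
     (\<exists>H. fib_map (cyl X) (\<lambda>z. p (fst z)) Y q H \<and> (\<forall>x \<in> topspace X. H (x, 0) = f x \<and> H (x, 1) = g x))"

definition fib_equiv ::
  "'x topology \<Rightarrow> ('x \<Rightarrow> 'b) \<Rightarrow> 'y topology \<Rightarrow> ('y \<Rightarrow> 'b) \<Rightarrow> ('x \<Rightarrow> 'y) \<Rightarrow> bool" where
  "fib_equiv X p Y q f \<longleftrightarrow> fib_map X p Y q f \<and>
     (\<exists>g. fib_map Y q X p g \<and> fib_homotopic X p X p (\<lambda>x. g (f x)) (\<lambda>x. x)
        \<and> fib_homotopic Y q Y q (\<lambda>y. f (g y)) (\<lambda>y. y))"

lemma fib_map_in_topspace: "fib_map X p Y q f \<Longrightarrow> x \<in> topspace X \<Longrightarrow> f x \<in> topspace Y"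
  using continuous_map_funspace by (fastforce simp: fib_map_def proper_cont_map_def)

lemma fib_map_over: "fib_map X p Y q f \<Longrightarrow> x \<in> topspace X \<Longrightarrow> q (f x) = p x"
  by (simp add: fib_map_def)

lemma fib_map_eq:
  assumes "fib_map X p Y q f" "\<And>x. x \<in> topspace X \<Longrightarrow> g x = f x"
  shows "fib_map X p Y q g"
  using assms proper_cont_map_eq[of X Y f g] by (simp add: fib_map_def)

lemma fib_map_id: "fib_map X p X p (\<lambda>x. x)"
proof -
  have "{x \<in> topspace X. x \<in> K} = K" if "closedin X K" for K
    using closedin_subset[OF that] by blast
  then show ?thesis
    by (simp add: fib_map_def proper_cont_map_def)
qed

lemma fib_map_compose:
  assumes "fib_map X p Y q f" "fib_map Y q Z z g"
  shows "fib_map X p Z z (\<lambda>x. g (f x))"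
  using assms fib_map_in_topspace[OF assms(1)]
  by (auto simp: fib_map_def intro: proper_cont_map_compose)

lemma fib_map_from_closed:
  assumes "fib_map X p Y q f" "closedin X S"
  shows "fib_map (subtopology X S) p Y q f"
  using assms by (auto simp: fib_map_def proper_cont_map_from_closed_subtopology)

lemma fib_map_into_closed:
  assumes f: "fib_map X p Y q f" and S: "closedin Y S"
    and im: "\<And>x. x \<in> topspace X \<Longrightarrow> f x \<in> S"
  shows "fib_map X p (subtopology Y S) q f"
  using f proper_cont_map_into_closed_subtopology[of X Y f, OF _ S im] by (simp add: fib_map_def)

lemma fib_map_from_smaller:
  assumes "fib_map (subtopology X T) p Y q f" "closedin X S" "S \<subseteq> T"
  shows "fib_map (subtopology X S) p Y q f"
  using fib_map_from_closed[OF assms(1) closedin_subset_topspace[OF assms(2,3)]] assms(3)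
  by (simp add: subtopology_subtopology inf_absorb2)

lemma fib_map_inclusion: "closedin Y S \<Longrightarrow> fib_map (subtopology Y S) q Y q (\<lambda>y. y)"
  by (rule fib_map_from_closed[OF fib_map_id])

lemma fib_map_glue:
  assumes "closedin X S" "closedin X T" "topspace X \<subseteq> S \<union> T"
    and "fib_map (subtopology X S) p Y q f" "fib_map (subtopology X T) p Y q f"
  shows "fib_map X p Y q f"
  using assms proper_cont_map_glue[OF assms(1-3)] by (auto simp: fib_map_def)

lemma closedin_level:
  assumes "continuous_map X euclideanreal \<theta>"
  shows "closedin X {x \<in> topspace X. \<theta> x \<le> c}" "closedin X {x \<in> topspace X. c \<le> \<theta> x}"
    "closedin X {x \<in> topspace X. c \<le> \<theta> x \<and> \<theta> x \<le> d}"
  using closedin_continuous_map_preimage[OF assms, of "{..c}"]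
    closedin_continuous_map_preimage[OF assms, of "{c..}"]
    closedin_continuous_map_preimage[OF assms, of "{c..d}"] by simp_all

lemma fib_map_cases_le:
  assumes \<theta>: "continuous_map X euclideanreal \<theta>"
    and f: "fib_map (subtopology X {x \<in> topspace X. \<theta> x \<le> c}) p Y q f"
    and g: "fib_map (subtopology X {x \<in> topspace X. c \<le> \<theta> x}) p Y q g"
    and fg: "\<And>x. x \<in> topspace X \<Longrightarrow> \<theta> x = c \<Longrightarrow> f x = g x"
  shows "fib_map X p Y q (\<lambda>x. if \<theta> x \<le> c then f x else g x)"
proof (rule fib_map_glue)
  show "closedin X {x \<in> topspace X. \<theta> x \<le> c}" "closedin X {x \<in> topspace X. c \<le> \<theta> x}"
    using \<theta> by (auto intro: closedin_level)
  show "fib_map (subtopology X {x \<in> topspace X. \<theta> x \<le> c}) p Y q (\<lambda>x. if \<theta> x \<le> c then f x else g x)"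
    by (rule fib_map_eq[OF f]) auto
  show "fib_map (subtopology X {x \<in> topspace X. c \<le> \<theta> x}) p Y q (\<lambda>x. if \<theta> x \<le> c then f x else g x)"
    by (rule fib_map_eq[OF g]) (auto simp: fg)
qed auto

lemma compact_space_unit_interval: "compact_space unit_interval"
  by (simp add: compact_space_subtopology compactin_euclidean_iff)

lemma fib_map_fst: "fib_map (cyl X) (\<lambda>z. p (fst z)) X p fst"
  by (simp add: fib_map_def proper_cont_map_fst_compact compact_space_unit_interval)

text \<open>All homotopies below are built by this substitution: both the point and the time at which
  \<open>H\<close> is evaluated may vary.\<close>

lemma fib_map_eval_homotopy:
  assumes H: "fib_map (cyl Y) (\<lambda>z. q (fst z)) W w H" and k: "fib_map Z z Y q k"
    and \<sigma>: "continuous_map Z euclideanreal \<sigma>"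
    and range: "\<And>x. x \<in> topspace Z \<Longrightarrow> 0 \<le> \<sigma> x \<and> \<sigma> x \<le> 1"
  shows "fib_map Z z W w (\<lambda>x. H (k x, \<sigma> x))"
proof -
  have "continuous_map Z unit_interval \<sigma>"
    using \<sigma> range by (auto simp: continuous_map_in_subtopology)
  then have "fib_map Z z (cyl Y) (\<lambda>v. q (fst v)) (\<lambda>x. (k x, \<sigma> x))"
    using k by (simp add: fib_map_def proper_cont_map_pair_compact compact_space_unit_interval)
  then show ?thesis
    using H by (rule fib_map_compose)
qed

lemma continuous_map_cyl_snd: "continuous_map (cyl X) euclideanreal snd"
  using continuous_map_snd[of X unit_interval] by (simp add: continuous_map_in_subtopology)

lemma continuous_map_cyl_fst:
  "continuous_map Y euclideanreal (\<lambda>y. \<tau> (q y)) \<Longrightarrow> continuous_map (cyl Y) euclideanreal (\<lambda>z. \<tau> (q (fst z)))"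
  using continuous_map_compose[OF continuous_map_fst, of Y euclideanreal "\<lambda>y. \<tau> (q y)"]
  by (simp add: o_def)

lemma fib_homotopic_endpoint:
  assumes "fib_homotopic X p Y q f g"
  shows "fib_map X p Y q f" "fib_map X p Y q g"
proof -
  obtain H where H: "fib_map (cyl X) (\<lambda>z. p (fst z)) Y q H"
    and ends: "\<And>x. x \<in> topspace X \<Longrightarrow> H (x, 0) = f x \<and> H (x, 1) = g x"
    using assms by (auto simp: fib_homotopic_def)
  have "fib_map X p Y q (\<lambda>x. H (x, 0))" "fib_map X p Y q (\<lambda>x. H (x, 1))"
    by (rule fib_map_eval_homotopy[OF H fib_map_id]; simp)+
  then show "fib_map X p Y q f" "fib_map X p Y q g"
    using ends by (auto elim: fib_map_eq)
qed

lemma fib_homotopic_sym: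
  assumes "fib_homotopic X p Y q f g"
  shows "fib_homotopic X p Y q g f"
proof -
  obtain H where H: "fib_map (cyl X) (\<lambda>z. p (fst z)) Y q H"
    and ends: "\<And>x. x \<in> topspace X \<Longrightarrow> H (x, 0) = f x \<and> H (x, 1) = g x"
    using assms by (auto simp: fib_homotopic_def)
  have "fib_map (cyl X) (\<lambda>z. p (fst z)) Y q (\<lambda>z. H (fst z, 1 - snd z))"
    by (rule fib_map_eval_homotopy[OF H fib_map_fst])
      (auto intro!: continuous_intros continuous_map_cyl_snd)
  then show ?thesis
    unfolding fib_homotopic_def using ends by (intro exI[of _ "\<lambda>z. H (fst z, 1 - snd z)"]) simp
qed

lemma fib_homotopic_trans:
  assumes "fib_homotopic X p Y q f g" "fib_homotopic X p Y q g h"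
  shows "fib_homotopic X p Y q f h"
proof -
  obtain H where H: "fib_map (cyl X) (\<lambda>z. p (fst z)) Y q H"
    and endsH: "\<And>x. x \<in> topspace X \<Longrightarrow> H (x, 0) = f x \<and> H (x, 1) = g x"
    using assms(1) by (auto simp: fib_homotopic_def)
  obtain G where G: "fib_map (cyl X) (\<lambda>z. p (fst z)) Y q G"
    and endsG: "\<And>x. x \<in> topspace X \<Longrightarrow> G (x, 0) = g x \<and> G (x, 1) = h x"
    using assms(2) by (auto simp: fib_homotopic_def)
  define L where "L = (\<lambda>z. if snd z \<le> 1/2 then H (fst z, 2 * snd z) else G (fst z, 2 * snd z - 1))"
  have "fib_map (cyl X) (\<lambda>z. p (fst z)) Y q L"
    unfolding L_def
  proof (rule fib_map_cases_le)
    show "fib_map (subtopology (cyl X) {z \<in> topspace (cyl X). snd z \<le> 1/2}) (\<lambda>z. p (fst z)) Y q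
        (\<lambda>z. H (fst z, 2 * snd z))"
      by (rule fib_map_eval_homotopy[OF H fib_map_from_closed[OF fib_map_fst closedin_level(1)[OF continuous_map_cyl_snd]]])
        (auto intro!: continuous_intros continuous_map_from_subtopology continuous_map_cyl_snd)
    show "fib_map (subtopology (cyl X) {z \<in> topspace (cyl X). 1/2 \<le> snd z}) (\<lambda>z. p (fst z)) Y q
        (\<lambda>z. G (fst z, 2 * snd z - 1))"
      by (rule fib_map_eval_homotopy[OF G fib_map_from_closed[OF fib_map_fst closedin_level(2)[OF continuous_map_cyl_snd]]])
        (auto intro!: continuous_intros continuous_map_from_subtopology continuous_map_cyl_snd)
    fix z assume z: "z \<in> topspace (cyl X)" "snd z = 1/2"
    then show "H (fst z, 2 * snd z) = G (fst z, 2 * snd z - 1)"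
      unfolding z(2) using endsH endsG by auto
  qed (rule continuous_map_cyl_snd)
  then show ?thesis
    unfolding fib_homotopic_def using endsH endsG by (intro exI[of _ L]) (simp add: L_def)
qed

lemma fib_homotopic_post:
  assumes "fib_homotopic X p Y q f g" "fib_map Y q Z z h"
  shows "fib_homotopic X p Z z (\<lambda>x. h (f x)) (\<lambda>x. h (g x))"
proof -
  obtain H where H: "fib_map (cyl X) (\<lambda>z. p (fst z)) Y q H"
    and ends: "\<And>x. x \<in> topspace X \<Longrightarrow> H (x, 0) = f x \<and> H (x, 1) = g x"
    using assms(1) by (auto simp: fib_homotopic_def)
  show ?thesis
    unfolding fib_homotopic_def using fib_map_compose[OF H assms(2)] ends
    by (intro exI[of _ "\<lambda>z. h (H z)"]) simp
qed

lemma fib_homotopic_pre: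
  assumes "fib_homotopic Y q Z z f g" "fib_map X p Y q h"
  shows "fib_homotopic X p Z z (\<lambda>x. f (h x)) (\<lambda>x. g (h x))"
proof -
  obtain H where H: "fib_map (cyl Y) (\<lambda>z. q (fst z)) Z z H"
    and ends: "\<And>y. y \<in> topspace Y \<Longrightarrow> H (y, 0) = f y \<and> H (y, 1) = g y"
    using assms(1) by (auto simp: fib_homotopic_def)
  have "fib_map (cyl X) (\<lambda>z. p (fst z)) Z z (\<lambda>v. H (h (fst v), snd v))"
    by (rule fib_map_eval_homotopy[OF H fib_map_compose[OF fib_map_fst assms(2)]])
      (auto intro: continuous_map_cyl_snd)
  then show ?thesis
    unfolding fib_homotopic_def using ends fib_map_in_topspace[OF assms(2)]
    by (intro exI[of _ "\<lambda>v. H (h (fst v), snd v)"]) simp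
qed

lemma fib_homotopic_into_closed:
  assumes "fib_homotopic X p Y q f g" "closedin Y {y \<in> topspace Y. P (q y)}"
    and "\<And>x. x \<in> topspace X \<Longrightarrow> P (p x)"
  shows "fib_homotopic X p (subtopology Y {y \<in> topspace Y. P (q y)}) q f g"
proof -
  obtain H where H: "fib_map (cyl X) (\<lambda>z. p (fst z)) Y q H"
    and ends: "\<And>x. x \<in> topspace X \<Longrightarrow> H (x, 0) = f x \<and> H (x, 1) = g x"
    using assms(1) by (auto simp: fib_homotopic_def)
  have "fib_map (cyl X) (\<lambda>z. p (fst z)) (subtopology Y {y \<in> topspace Y. P (q y)}) q H"
    using H assms(2)
    by (rule fib_map_into_closed)
      (use fib_map_over[OF H] fib_map_in_topspace[OF H] assms(3) in auto)
  then show ?thesis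
    unfolding fib_homotopic_def using ends by blast
qed

text \<open>The usual \<open>l \<simeq> l f r \<simeq> r\<close>.\<close>

lemma left_right_inverse_homotopic:
  assumes f: "fib_map X p Y q f" and l: "fib_map Y q X p l" and r: "fib_map Y q X p r"
    and lf: "fib_homotopic X p X p (\<lambda>x. l (f x)) (\<lambda>x. x)"
    and fr: "fib_homotopic Y q Y q (\<lambda>y. f (r y)) (\<lambda>y. y)"
  shows "fib_homotopic Y q X p l r"
  using fib_homotopic_trans[OF fib_homotopic_sym[OF fib_homotopic_post[OF fr l]]
      fib_homotopic_pre[OF lf r]] .

lemma fib_equivI_left_right:
  assumes f: "fib_map X p Y q f" and l: "fib_map Y q X p l" and r: "fib_map Y q X p r"
    and lf: "fib_homotopic X p X p (\<lambda>x. l (f x)) (\<lambda>x. x)"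
    and fr: "fib_homotopic Y q Y q (\<lambda>y. f (r y)) (\<lambda>y. y)"
  shows "fib_equiv X p Y q f"
proof -
  have "fib_homotopic X p X p (\<lambda>x. r (f x)) (\<lambda>x. l (f x))"
    using fib_homotopic_pre[OF fib_homotopic_sym[OF left_right_inverse_homotopic[OF assms]] f] .
  then show ?thesis
    unfolding fib_equiv_def using f r fr fib_homotopic_trans[OF _ lf] by blast
qed


lemma fib_equiv_homotopic:
  assumes f: "fib_equiv X p Y q f" and fg: "fib_homotopic X p Y q f g"
  shows "fib_equiv X p Y q g"
proof -
  obtain h where h: "fib_map Y q X p h" "fib_homotopic X p X p (\<lambda>x. h (f x)) (\<lambda>x. x)"
    "fib_homotopic Y q Y q (\<lambda>y. f (h y)) (\<lambda>y. y)"
    using f by (auto simp: fib_equiv_def)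
  have gf: "fib_homotopic X p Y q g f"
    using fg by (rule fib_homotopic_sym)
  have "fib_homotopic X p X p (\<lambda>x. h (g x)) (\<lambda>x. x)"
    using fib_homotopic_trans[OF fib_homotopic_post[OF gf h(1)] h(2)] .
  moreover have "fib_homotopic Y q Y q (\<lambda>y. g (h y)) (\<lambda>y. y)"
    using fib_homotopic_trans[OF fib_homotopic_pre[OF gf h(1)] h(3)] .
  ultimately show ?thesis
    unfolding fib_equiv_def using h(1) fib_homotopic_endpoint(2)[OF fg] by blast
qed

text \<open>An inverse of \<open>g f\<close> gives \<open>f\<close> a left inverse and an inverse of \<open>f g\<close> gives it a right
  inverse, up to homotopy.\<close>

lemma fib_equiv_of_composites:
  assumes f: "fib_map X p Y q f" and g: "fib_map Y q X p g"
    and gf: "fib_equiv X p X p (\<lambda>x. g (f x))" and fg: "fib_equiv Y q Y q (\<lambda>y. f (g y))"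
  shows "fib_equiv X p Y q f"
proof -
  obtain v where v: "fib_map X p X p v" "fib_homotopic X p X p (\<lambda>x. v (g (f x))) (\<lambda>x. x)"
    using gf by (auto simp: fib_equiv_def)
  obtain w where w: "fib_map Y q Y q w" "fib_homotopic Y q Y q (\<lambda>y. f (g (w y))) (\<lambda>y. y)"
    using fg by (auto simp: fib_equiv_def)
  show ?thesis
    using f fib_map_compose[OF g v(1)] fib_map_compose[OF w(1) g] v(2) w(2)
    by (rule fib_equivI_left_right)
qed

section \<open>Restriction to parts of the base\<close>

lemma fib_map_restrict:
  assumes f: "fib_map (preimage_space X p S) p (preimage_space Y q S) q f" and "T \<subseteq> S"
    and X: "closedin X {x \<in> topspace X. p x \<in> T}" and Y: "closedin Y {y \<in> topspace Y. q y \<in> T}"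
  shows "fib_map (preimage_space X p T) p (preimage_space Y q T) q f"
proof -
  have sub: "subtopology (preimage_space Y q S) {y \<in> topspace Y. q y \<in> T} = preimage_space Y q T"
    unfolding subtopology_subtopology using \<open>T \<subseteq> S\<close> by (intro arg_cong[of _ _ "subtopology Y"]) auto
  have "fib_map (preimage_space X p T) p (preimage_space Y q S) q f"
    using f X by (rule fib_map_from_smaller) (use \<open>T \<subseteq> S\<close> in auto)
  moreover have "closedin (preimage_space Y q S) {y \<in> topspace Y. q y \<in> T}"
    using Y by (rule closedin_subset_topspace) (use \<open>T \<subseteq> S\<close> in auto)
  ultimately have "fib_map (preimage_space X p T) p
      (subtopology (preimage_space Y q S) {y \<in> topspace Y. q y \<in> T}) q f"
    by (rule fib_map_into_closed)
       (use fib_map_in_topspace[OF f] fib_map_over[OF f] \<open>T \<subseteq> S\<close> in auto)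
  then show ?thesis
    unfolding sub .
qed

lemma fib_homotopic_restrict:
  assumes fg: "fib_homotopic (preimage_space X p S) p (preimage_space Y q S) q f g" and "T \<subseteq> S"
    and X: "closedin X {x \<in> topspace X. p x \<in> T}" and Y: "closedin Y {y \<in> topspace Y. q y \<in> T}"
  shows "fib_homotopic (preimage_space X p T) p (preimage_space Y q T) q f g"
proof -
  have sub: "subtopology (preimage_space Y q S) {y \<in> topspace (preimage_space Y q S). q y \<in> T} = preimage_space Y q T"
    unfolding subtopology_subtopology using \<open>T \<subseteq> S\<close> by (intro arg_cong[of _ _ "subtopology Y"]) auto
  have "fib_map (preimage_space X p T) p (preimage_space X p S) p (\<lambda>x. x)"
    by (rule fib_map_from_smaller[OF fib_map_id X]) (use \<open>T \<subseteq> S\<close> in auto)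
  then have *: "fib_homotopic (preimage_space X p T) p (preimage_space Y q S) q f g"
    using fib_homotopic_pre[OF fg] by blast
  have "closedin (preimage_space Y q S) {y \<in> topspace Y. q y \<in> T}"
    using Y by (rule closedin_subset_topspace) (use \<open>T \<subseteq> S\<close> in auto)
  also have "{y \<in> topspace Y. q y \<in> T} = {y \<in> topspace (preimage_space Y q S). q y \<in> T}"
    using \<open>T \<subseteq> S\<close> by auto
  finally have "fib_homotopic (preimage_space X p T) p
      (subtopology (preimage_space Y q S) {y \<in> topspace (preimage_space Y q S). q y \<in> T}) q f g"
    by (rule fib_homotopic_into_closed[OF *]) auto
  then show ?thesis
    unfolding sub .
qed

abbreviation fib_equiv_on ::
  "'x topology \<Rightarrow> ('x \<Rightarrow> 'b) \<Rightarrow> 'y topology \<Rightarrow> ('y \<Rightarrow> 'b) \<Rightarrow> ('x \<Rightarrow> 'y) \<Rightarrow> 'b set \<Rightarrow> bool" where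
  "fib_equiv_on X p Y q f S \<equiv> fib_equiv (preimage_space X p S) p (preimage_space Y q S) q f"

lemma fib_equiv_on_subset:
  assumes f: "fib_equiv_on X p Y q f S" and TS: "T \<subseteq> S"
    and X: "closedin X {x \<in> topspace X. p x \<in> T}" and Y: "closedin Y {y \<in> topspace Y. q y \<in> T}"
  shows "fib_equiv_on X p Y q f T"
  using f fib_map_restrict[OF _ TS X Y] fib_map_restrict[OF _ TS Y X]
    fib_homotopic_restrict[OF _ TS X X] fib_homotopic_restrict[OF _ TS Y Y]
  unfolding fib_equiv_def by blast

lemma fib_map_preimage:
  assumes f: "fib_map X p Y q f"
    and X: "closedin X {x \<in> topspace X. p x \<in> S}" and Y: "closedin Y {y \<in> topspace Y. q y \<in> S}"
  shows "fib_map (preimage_space X p S) p (preimage_space Y q S) q f"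
  using fib_map_restrict[of X p UNIV Y q f S] f X Y by simp

lemma preimage_space_preimage_space:
  "preimage_space (preimage_space X p S) p T = preimage_space X p (S \<inter> T)"
  unfolding subtopology_subtopology by (intro arg_cong[of _ _ "subtopology X"]) auto

section \<open>Maps that are locally homotopic to the identity\<close>

text \<open>For a function \<open>\<tau>\<close> on the base, the parts \<open>\<tau> \<le> 1\<close> and \<open>\<tau> \<ge> 0\<close> cover everything, and they
  overlap in a band on which \<open>\<tau>\<close> itself serves as a time parameter.\<close>

abbreviation sublevel :: "'y topology \<Rightarrow> ('y \<Rightarrow> 'b) \<Rightarrow> ('b \<Rightarrow> real) \<Rightarrow> 'y topology" where
  "sublevel Y q \<tau> \<equiv> subtopology Y {y \<in> topspace Y. \<tau> (q y) \<le> 1}"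

abbreviation superlevel :: "'y topology \<Rightarrow> ('y \<Rightarrow> 'b) \<Rightarrow> ('b \<Rightarrow> real) \<Rightarrow> 'y topology" where
  "superlevel Y q \<tau> \<equiv> subtopology Y {y \<in> topspace Y. 0 \<le> \<tau> (q y)}"

abbreviation band :: "'y topology \<Rightarrow> ('y \<Rightarrow> 'b) \<Rightarrow> ('b \<Rightarrow> real) \<Rightarrow> 'y topology" where
  "band Y q \<tau> \<equiv> subtopology Y {y \<in> topspace Y. 0 \<le> \<tau> (q y) \<and> \<tau> (q y) \<le> 1}"

lemma fib_map_band_cases:
  assumes \<theta>: "continuous_map X euclideanreal \<theta>" and e: "fib_map X p Y q e"
    and h: "fib_map (subtopology X {x \<in> topspace X. 0 \<le> \<theta> x \<and> \<theta> x \<le> 1}) p Y q h"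
    and ends: "\<And>x. x \<in> topspace X \<Longrightarrow> \<theta> x = 0 \<or> \<theta> x = 1 \<Longrightarrow> h x = e x"
  shows "fib_map X p Y q (\<lambda>x. if 0 \<le> \<theta> x \<and> \<theta> x \<le> 1 then h x else e x)"
proof (rule fib_map_glue)
  let ?T = "{x \<in> topspace X. \<theta> x \<le> 0} \<union> {x \<in> topspace X. 1 \<le> \<theta> x}"
  show "closedin X {x \<in> topspace X. 0 \<le> \<theta> x \<and> \<theta> x \<le> 1}" and T: "closedin X ?T"
    using \<theta> by (auto intro: closedin_level)
  show "fib_map (subtopology X {x \<in> topspace X. 0 \<le> \<theta> x \<and> \<theta> x \<le> 1}) p Y q
      (\<lambda>x. if 0 \<le> \<theta> x \<and> \<theta> x \<le> 1 then h x else e x)"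
    by (rule fib_map_eq[OF h]) auto
  show "fib_map (subtopology X ?T) p Y q (\<lambda>x. if 0 \<le> \<theta> x \<and> \<theta> x \<le> 1 then h x else e x)"
  proof (rule fib_map_eq[OF fib_map_from_closed[OF e T]])
    fix x assume "x \<in> topspace (subtopology X ?T)"
    then have "x \<in> topspace X" "\<theta> x \<le> 0 \<or> 1 \<le> \<theta> x"
      by auto
    then show "(if 0 \<le> \<theta> x \<and> \<theta> x \<le> 1 then h x else e x) = e x"
      using ends[of x] by auto
  qed
qed auto

text \<open>For a loop \<open>K\<close> of maps over the band from the identity to the identity, crossing the band
  runs once through the loop. These maps play the role of clutching functions.\<close>

definition twist :: "('y \<Rightarrow> 'b) \<Rightarrow> ('b \<Rightarrow> real) \<Rightarrow> ('y \<times> real \<Rightarrow> 'y) \<Rightarrow> 'y \<Rightarrow> 'y" where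
  "twist q \<tau> K y = (if 0 \<le> \<tau> (q y) \<and> \<tau> (q y) \<le> 1 then K (y, \<tau> (q y)) else y)"

lemma fib_map_twist:
  assumes \<tau>: "continuous_map Y euclideanreal (\<lambda>y. \<tau> (q y))"
    and K: "fib_map (cyl (band Y q \<tau>)) (\<lambda>z. q (fst z)) Y q K"
    and ends: "\<And>y. y \<in> topspace (band Y q \<tau>) \<Longrightarrow> K (y, 0) = y \<and> K (y, 1) = y"
  shows "fib_map Y q Y q (twist q \<tau> K)"
  unfolding twist_def
proof (rule fib_map_band_cases[OF \<tau> fib_map_id])
  show "fib_map (band Y q \<tau>) q Y q (\<lambda>y. K (y, \<tau> (q y)))"
    by (rule fib_map_eval_homotopy[OF K fib_map_id])
      (auto intro: \<tau> continuous_map_from_subtopology)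
qed (use ends in auto)

text \<open>At level \<open>t\<close> of the band the composite is \<open>K\<close> at time \<open>t\<close> followed by \<open>K\<close> at time
  \<open>1 - t\<close>. The path \<open>t \<mapsto> (t, 1 - t)\<close> of pairs of times can be pushed, with fixed endpoints, to the two
  sides of the unit square that meet at \<open>(0, 0)\<close>. There one of the two factors is the identity, so what
  is left is the loop \<open>K\<close> run backwards and then forwards, which contracts.\<close>

lemma twist_reverse:
  assumes \<tau>: "continuous_map Y euclideanreal (\<lambda>y. \<tau> (q y))"
    and K: "fib_map (cyl (band Y q \<tau>)) (\<lambda>z. q (fst z)) Y q K"
    and ends: "\<And>y. y \<in> topspace (band Y q \<tau>) \<Longrightarrow> K (y, 0) = y \<and> K (y, 1) = y"
  shows "fib_homotopic Y q Y q (\<lambda>y. twist q \<tau> (\<lambda>z. K (fst z, 1 - snd z)) (twist q \<tau> K y)) (\<lambda>y. y)"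
proof -
  let ?\<theta> = "\<lambda>z. \<tau> (q (fst z))"
  let ?Z = "subtopology (cyl Y) {z \<in> topspace (cyl Y). 0 \<le> ?\<theta> z \<and> ?\<theta> z \<le> 1}"
  have K_over: "q (K (y, s)) = q y" "K (y, s) \<in> topspace Y"
    if "y \<in> topspace (band Y q \<tau>)" "0 \<le> s" "s \<le> 1" for y s
    using fib_map_over[OF K, of "(y, s)"] fib_map_in_topspace[OF K, of "(y, s)"] that by auto
  have \<theta>: "continuous_map (cyl Y) euclideanreal ?\<theta>"
    using \<tau> by (rule continuous_map_cyl_fst)
  have band_closed: "closedin Y {y \<in> topspace Y. 0 \<le> \<tau> (q y) \<and> \<tau> (q y) \<le> 1}"
    using \<tau> by (rule closedin_level)
  have fst_Z: "fib_map ?Z (\<lambda>z. q (fst z)) (band Y q \<tau>) q fst"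
    by (rule fib_map_into_closed[OF fib_map_from_closed[OF fib_map_fst closedin_level(3)[OF \<theta>]] band_closed])
      auto
  (* m is how far the pair of times (t, 1 - t) has been moved down the diagonal; at the end it is
     the smaller of the two, so that this one becomes 0. *)
  define m where "m z = snd z * min (?\<theta> z) (1 - ?\<theta> z)" for z :: "'a \<times> real"
  have cont: "continuous_map ?Z euclideanreal ?\<theta>" "continuous_map ?Z euclideanreal snd"
    using \<theta> continuous_map_cyl_snd by (auto intro: continuous_map_from_subtopology)
  have m: "continuous_map ?Z euclideanreal m"
    unfolding m_def by (intro continuous_intros cont)
  have m_bounds: "0 \<le> m z \<and> m z \<le> ?\<theta> z \<and> m z \<le> 1 - ?\<theta> z" if "z \<in> topspace ?Z" for z
  proof -
    have "0 \<le> snd z" "snd z \<le> 1" "0 \<le> min (?\<theta> z) (1 - ?\<theta> z)"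
      using that by auto
    then have "0 \<le> m z" "m z \<le> min (?\<theta> z) (1 - ?\<theta> z)"
      unfolding m_def by (simp_all only: mult_nonneg_nonneg mult_left_le_one_le)
    then show ?thesis
      by simp
  qed
  have inner: "fib_map ?Z (\<lambda>z. q (fst z)) Y q (\<lambda>z. K (fst z, ?\<theta> z - m z))"
    by (rule fib_map_eval_homotopy[OF K fst_Z])
      (use m_bounds in \<open>fastforce intro!: continuous_intros cont m\<close>)+
  have "fib_map ?Z (\<lambda>z. q (fst z)) (band Y q \<tau>) q (\<lambda>z. K (fst z, ?\<theta> z - m z))"
    using inner band_closed
    by (rule fib_map_into_closed)
      (use fib_map_over[OF inner] fib_map_in_topspace[OF inner] in auto)
  then have outer: "fib_map ?Z (\<lambda>z. q (fst z)) Y q (\<lambda>z. K (K (fst z, ?\<theta> z - m z), 1 - ?\<theta> z - m z))"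
    by (rule fib_map_eval_homotopy[OF K])
      (use m_bounds in \<open>fastforce intro!: continuous_intros cont m\<close>)+
  let ?H = "\<lambda>z. if 0 \<le> ?\<theta> z \<and> ?\<theta> z \<le> 1
      then K (K (fst z, ?\<theta> z - m z), 1 - ?\<theta> z - m z) else fst z"
  let ?P = "\<lambda>y. if 0 \<le> \<tau> (q y) \<and> \<tau> (q y) \<le> 1 then K (y, \<bar>2 * \<tau> (q y) - 1\<bar>) else y"
  have "fib_map (cyl Y) (\<lambda>z. q (fst z)) Y q ?H"
    using \<theta> fib_map_fst outer by (rule fib_map_band_cases) (auto simp: m_def ends)
  moreover have "?H (y, 0) = twist q \<tau> (\<lambda>z. K (fst z, 1 - snd z)) (twist q \<tau> K y)"
    if "y \<in> topspace Y" for y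
    using that K_over(1)[of y "\<tau> (q y)"] by (auto simp: twist_def m_def)
  moreover have "?H (y, 1) = ?P y" if y: "y \<in> topspace Y" for y
  proof (cases "0 \<le> \<tau> (q y) \<and> \<tau> (q y) \<le> 1")
    case True
    then have yb: "y \<in> topspace (band Y q \<tau>)"
      using y by simp
    show ?thesis
    proof (cases "\<tau> (q y) \<le> 1/2")
      case True
      then show ?thesis
        using ends[OF yb] by (auto simp: m_def)
    next
      case False
      then have "K (y, 2 * \<tau> (q y) - 1) \<in> topspace (band Y q \<tau>)"
        using K_over[OF yb, of "2 * \<tau> (q y) - 1"] True by auto
      then show ?thesis
        using False ends by (auto simp: m_def)
    qed
  qed auto
  ultimately have first: "fib_homotopic Y q Y q
      (\<lambda>y. twist q \<tau> (\<lambda>z. K (fst z, 1 - snd z)) (twist q \<tau> K y)) ?P"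
    unfolding fib_homotopic_def by (intro exI[of _ ?H]) simp
  (* K at time \<bar>2 t - 1\<bar> runs back to the start of the loop and forth again; raising this time to
     the constant 1 contracts it. *)
  let ?n = "\<lambda>z. \<bar>2 * ?\<theta> z - 1\<bar> + snd z * (1 - \<bar>2 * ?\<theta> z - 1\<bar>)"
  let ?G = "\<lambda>z. if 0 \<le> ?\<theta> z \<and> ?\<theta> z \<le> 1 then K (fst z, ?n z) else fst z"
  have n_bounds: "0 \<le> ?n z \<and> ?n z \<le> 1" if "z \<in> topspace ?Z" for z
  proof -
    have "0 \<le> snd z" "snd z \<le> 1" "0 \<le> 1 - \<bar>2 * ?\<theta> z - 1\<bar>"
      using that by auto
    then have "0 \<le> snd z * (1 - \<bar>2 * ?\<theta> z - 1\<bar>)"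
      "snd z * (1 - \<bar>2 * ?\<theta> z - 1\<bar>) \<le> 1 - \<bar>2 * ?\<theta> z - 1\<bar>"
      by (auto intro: mult_nonneg_nonneg mult_left_le_one_le)
    then show ?thesis
      by linarith
  qed
  have "fib_map ?Z (\<lambda>z. q (fst z)) Y q (\<lambda>z. K (fst z, ?n z))"
    using n_bounds by (intro fib_map_eval_homotopy[OF K fst_Z] continuous_intros cont) auto
  then have "fib_map (cyl Y) (\<lambda>z. q (fst z)) Y q ?G"
    using \<theta> fib_map_fst by (intro fib_map_band_cases) (auto simp: ends)
  then have "fib_homotopic Y q Y q ?P (\<lambda>y. y)"
    unfolding fib_homotopic_def by (intro exI[of _ ?G]) (auto simp: ends)
  with first show ?thesis
    by (rule fib_homotopic_trans)
qed

lemma fib_equiv_twist: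
  assumes \<tau>: "continuous_map Y euclideanreal (\<lambda>y. \<tau> (q y))"
    and K: "fib_map (cyl (band Y q \<tau>)) (\<lambda>z. q (fst z)) Y q K"
    and ends: "\<And>y. y \<in> topspace (band Y q \<tau>) \<Longrightarrow> K (y, 0) = y \<and> K (y, 1) = y"
  shows "fib_equiv Y q Y q (twist q \<tau> K)"
proof -
  let ?K' = "\<lambda>z. K (fst z, 1 - snd z)"
  have K': "fib_map (cyl (band Y q \<tau>)) (\<lambda>z. q (fst z)) Y q ?K'"
    by (rule fib_map_eval_homotopy[OF K fib_map_fst])
      (auto intro!: continuous_intros continuous_map_cyl_snd)
  have ends': "?K' (y, 0) = y \<and> ?K' (y, 1) = y" if "y \<in> topspace (band Y q \<tau>)" for y
    using ends[OF that] by simp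
  show ?thesis
    unfolding fib_equiv_def
    using fib_map_twist[OF \<tau> K ends] fib_map_twist[OF \<tau> K' ends'] twist_reverse[OF \<tau> K ends]
      twist_reverse[OF \<tau> K' ends']
    by (intro conjI exI[of _ "twist q \<tau> ?K'"]) simp_all
qed

text \<open>The homotopies to the identity over the two parts need not agree on the overlap. Together they form a loop \<open>K\<close>, namely from the identity to \<open>u\<close> by one of them and back by
  the other, and \<open>u\<close> is homotopic over the whole base to the twist along \<open>K\<close>: near the level
  \<open>\<tau> = 1/2\<close> it stays \<open>u\<close>, and away from it each homotopy is run to its end.\<close>

lemma fib_equiv_locally_homotopic_id:
  assumes \<tau>: "continuous_map Y euclideanreal (\<lambda>y. \<tau> (q y))"
    and u: "fib_map Y q Y q u"
    and above: "fib_homotopic (superlevel Y q \<tau>) q Y q (\<lambda>y. y) u"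
    and below: "fib_homotopic (sublevel Y q \<tau>) q Y q u (\<lambda>y. y)"
  shows "fib_equiv Y q Y q u"
proof -
  obtain A where A: "fib_map (cyl (superlevel Y q \<tau>)) (\<lambda>z. q (fst z)) Y q A"
    and endsA: "\<And>y. y \<in> topspace (superlevel Y q \<tau>) \<Longrightarrow> A (y, 0) = y \<and> A (y, 1) = u y"
    using above by (auto simp: fib_homotopic_def)
  obtain B where B: "fib_map (cyl (sublevel Y q \<tau>)) (\<lambda>z. q (fst z)) Y q B"
    and endsB: "\<And>y. y \<in> topspace (sublevel Y q \<tau>) \<Longrightarrow> B (y, 0) = u y \<and> B (y, 1) = y"
    using below by (auto simp: fib_homotopic_def)
  let ?\<theta> = "\<lambda>z. \<tau> (q (fst z))"
  note levels = closedin_level[OF \<tau>]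
  have \<theta>: "continuous_map (cyl Y) euclideanreal ?\<theta>"
    using \<tau> by (rule continuous_map_cyl_fst)
  define K where "K z = (if snd z \<le> 1/2 then B (fst z, 1 - 2 * snd z) else A (fst z, 2 - 2 * snd z))" for z
  have K: "fib_map (cyl (band Y q \<tau>)) (\<lambda>z. q (fst z)) Y q K"
    unfolding K_def
  proof (rule fib_map_cases_le)
    let ?C = "cyl (band Y q \<tau>)"
    have fstC: "fib_map ?C (\<lambda>z. q (fst z)) Y q fst"
      using fib_map_compose[OF fib_map_fst fib_map_inclusion[OF levels(3)]] .
    have "fib_map (subtopology ?C {z \<in> topspace ?C. snd z \<le> 1/2}) (\<lambda>z. q (fst z)) (sublevel Y q \<tau>) q fst"
      by (rule fib_map_into_closed[OF fib_map_from_closed[OF fstC closedin_level(1)[OF continuous_map_cyl_snd]]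
            levels(1)]) auto
    then show "fib_map (subtopology ?C {z \<in> topspace ?C. snd z \<le> 1/2}) (\<lambda>z. q (fst z)) Y q
        (\<lambda>z. B (fst z, 1 - 2 * snd z))"
      by (rule fib_map_eval_homotopy[OF B])
        (auto intro!: continuous_intros continuous_map_from_subtopology continuous_map_cyl_snd)
    have "fib_map (subtopology ?C {z \<in> topspace ?C. 1/2 \<le> snd z}) (\<lambda>z. q (fst z)) (superlevel Y q \<tau>) q fst"
      by (rule fib_map_into_closed[OF fib_map_from_closed[OF fstC closedin_level(2)[OF continuous_map_cyl_snd]]
            levels(2)]) auto
    then show "fib_map (subtopology ?C {z \<in> topspace ?C. 1/2 \<le> snd z}) (\<lambda>z. q (fst z)) Y q
        (\<lambda>z. A (fst z, 2 - 2 * snd z))"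
      by (rule fib_map_eval_homotopy[OF A])
        (auto intro!: continuous_intros continuous_map_from_subtopology continuous_map_cyl_snd)
    fix z assume z: "z \<in> topspace ?C" "snd z = 1/2"
    then show "B (fst z, 1 - 2 * snd z) = A (fst z, 2 - 2 * snd z)"
      unfolding z(2) using endsA endsB by auto
  qed (rule continuous_map_cyl_snd)
  have endsK: "K (y, 0) = y \<and> K (y, 1) = y" if "y \<in> topspace (band Y q \<tau>)" for y
    using that endsA[of y] endsB[of y] by (auto simp: K_def)
  (* The truncation at 1 makes D stop at the end of each homotopy outside the band, where K is not
     defined and the twist is the identity. *)
  define D where "D z = (if ?\<theta> z \<le> 1/2 then B (fst z, snd z * min 1 (1 - 2 * ?\<theta> z))
      else A (fst z, 1 - snd z * min 1 (2 * ?\<theta> z - 1)))" for z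
  have clamp: "0 \<le> t * min 1 a \<and> t * min 1 a \<le> 1" if "0 \<le> t" "t \<le> 1" "0 \<le> a" for t a :: real
    using that by (auto intro: mult_le_one)
  have "fib_map (cyl Y) (\<lambda>z. q (fst z)) Y q D"
    unfolding D_def
  proof (rule fib_map_cases_le[OF \<theta>])
    have *: "fib_map (subtopology (cyl Y) {z \<in> topspace (cyl Y). ?\<theta> z \<le> 1/2}) (\<lambda>z. q (fst z))
        (sublevel Y q \<tau>) q fst"
      by (rule fib_map_into_closed[OF fib_map_from_closed[OF fib_map_fst closedin_level(1)[OF \<theta>]]
            levels(1)]) auto
    show "fib_map (subtopology (cyl Y) {z \<in> topspace (cyl Y). ?\<theta> z \<le> 1/2}) (\<lambda>z. q (fst z)) Y q
        (\<lambda>z. B (fst z, snd z * min 1 (1 - 2 * ?\<theta> z)))"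
    proof (rule fib_map_eval_homotopy[OF B *])
      show "continuous_map (subtopology (cyl Y) {z \<in> topspace (cyl Y). ?\<theta> z \<le> 1/2}) euclideanreal
          (\<lambda>z. snd z * min 1 (1 - 2 * ?\<theta> z))"
        by (intro continuous_map_from_subtopology continuous_intros continuous_map_cyl_snd \<theta>)
    qed (use clamp in auto)
    have *: "fib_map (subtopology (cyl Y) {z \<in> topspace (cyl Y). 1/2 \<le> ?\<theta> z}) (\<lambda>z. q (fst z))
        (superlevel Y q \<tau>) q fst"
      by (rule fib_map_into_closed[OF fib_map_from_closed[OF fib_map_fst closedin_level(2)[OF \<theta>]]
            levels(2)]) auto
    show "fib_map (subtopology (cyl Y) {z \<in> topspace (cyl Y). 1/2 \<le> ?\<theta> z}) (\<lambda>z. q (fst z)) Y q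
        (\<lambda>z. A (fst z, 1 - snd z * min 1 (2 * ?\<theta> z - 1)))"
    proof (rule fib_map_eval_homotopy[OF A *])
      show "continuous_map (subtopology (cyl Y) {z \<in> topspace (cyl Y). 1/2 \<le> ?\<theta> z}) euclideanreal
          (\<lambda>z. 1 - snd z * min 1 (2 * ?\<theta> z - 1))"
        by (intro continuous_map_from_subtopology continuous_intros continuous_map_cyl_snd \<theta>)
    qed (use clamp in auto)
    fix z assume z: "z \<in> topspace (cyl Y)" "\<tau> (q (fst z)) = 1/2"
    then have "fst z \<in> topspace (sublevel Y q \<tau>)" "fst z \<in> topspace (superlevel Y q \<tau>)"
      by auto
    then show "B (fst z, snd z * min 1 (1 - 2 * ?\<theta> z)) = A (fst z, 1 - snd z * min 1 (2 * ?\<theta> z - 1))"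
      unfolding z(2) using endsA endsB by simp
  qed
  moreover have "D (y, 0) = u y" if "y \<in> topspace Y" for y
    using that endsA[of y] endsB[of y] by (auto simp: D_def)
  moreover have "D (y, 1) = twist q \<tau> K y" if y: "y \<in> topspace Y" for y
  proof -
    consider "\<tau> (q y) < 0" | "0 \<le> \<tau> (q y)" "\<tau> (q y) \<le> 1" | "1 < \<tau> (q y)"
      by linarith
    then show ?thesis
      using y endsA[of y] endsB[of y] by cases (auto simp: D_def K_def twist_def)
  qed
  ultimately have "fib_homotopic Y q Y q u (twist q \<tau> K)"
    unfolding fib_homotopic_def by blast
  then show ?thesis
    using fib_equiv_homotopic[OF fib_equiv_twist[OF \<tau> K endsK] fib_homotopic_sym] by blast
qed

section \<open>Gluing equivalences over two overlapping parts of the base\<close>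

text \<open>The glued map runs through the homotopy from \<open>a\<close> to \<open>b\<close> while \<open>\<tau>\<close> runs from 0 to 1. Over
  each part it is homotopic to the map given there by sliding back along that homotopy.\<close>

lemma fib_map_glue_homotopic:
  assumes \<tau>: "continuous_map Y euclideanreal (\<lambda>y. \<tau> (q y))"
    and a: "fib_map (sublevel Y q \<tau>) q W w a" and b: "fib_map (superlevel Y q \<tau>) q W w b"
    and ab: "fib_homotopic (band Y q \<tau>) q W w a b"
  obtains h where "fib_map Y q W w h"
    "fib_homotopic (sublevel Y q \<tau>) q W w a h" "fib_homotopic (superlevel Y q \<tau>) q W w b h"
proof -
  obtain H where H: "fib_map (cyl (band Y q \<tau>)) (\<lambda>z. q (fst z)) W w H"
    and ends: "\<And>y. y \<in> topspace (band Y q \<tau>) \<Longrightarrow> H (y, 0) = a y \<and> H (y, 1) = b y"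
    using ab by (auto simp: fib_homotopic_def)
  let ?\<theta> = "\<lambda>z. \<tau> (q (fst z))"
  let ?L = "cyl (sublevel Y q \<tau>)" and ?U = "cyl (superlevel Y q \<tau>)"
  note levels = closedin_level[OF \<tau>]
  have \<theta>: "continuous_map ?L euclideanreal ?\<theta>" "continuous_map ?U euclideanreal ?\<theta>"
    using \<tau> by (auto intro!: continuous_map_cyl_fst continuous_map_from_subtopology)
  have fstL: "fib_map ?L (\<lambda>z. q (fst z)) Y q fst"
    using fib_map_compose[OF fib_map_fst fib_map_inclusion[OF levels(1)]] .
  have fstU: "fib_map ?U (\<lambda>z. q (fst z)) Y q fst"
    using fib_map_compose[OF fib_map_fst fib_map_inclusion[OF levels(2)]] .
  define M where "M z = (if ?\<theta> z \<le> 0 then a (fst z) else H (fst z, snd z * ?\<theta> z))" for z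
  define N where "N z = (if ?\<theta> z \<le> 1 then H (fst z, 1 - snd z * (1 - ?\<theta> z)) else b (fst z))" for z
  have M: "fib_map ?L (\<lambda>z. q (fst z)) W w M"
    unfolding M_def
  proof (rule fib_map_cases_le[OF \<theta>(1)])
    show "fib_map (subtopology ?L {z \<in> topspace ?L. ?\<theta> z \<le> 0}) (\<lambda>z. q (fst z)) W w (\<lambda>z. a (fst z))"
      by (rule fib_map_from_closed[OF fib_map_compose[OF fib_map_fst a] closedin_level(1)[OF \<theta>(1)]])
    have *: "fib_map (subtopology ?L {z \<in> topspace ?L. 0 \<le> ?\<theta> z}) (\<lambda>z. q (fst z)) (band Y q \<tau>) q fst"
      by (rule fib_map_into_closed[OF fib_map_from_closed[OF fstL closedin_level(2)[OF \<theta>(1)]]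
            levels(3)]) auto
    show "fib_map (subtopology ?L {z \<in> topspace ?L. 0 \<le> ?\<theta> z}) (\<lambda>z. q (fst z)) W w
        (\<lambda>z. H (fst z, snd z * ?\<theta> z))"
    proof (rule fib_map_eval_homotopy[OF H *])
      show "continuous_map (subtopology ?L {z \<in> topspace ?L. 0 \<le> ?\<theta> z}) euclideanreal
          (\<lambda>z. snd z * ?\<theta> z)"
        by (intro continuous_map_from_subtopology continuous_intros continuous_map_cyl_snd \<theta>)
    qed (auto intro: mult_le_one)
  qed (use ends in auto)
  have N: "fib_map ?U (\<lambda>z. q (fst z)) W w N"
    unfolding N_def
  proof (rule fib_map_cases_le[OF \<theta>(2)])
    show "fib_map (subtopology ?U {z \<in> topspace ?U. 1 \<le> ?\<theta> z}) (\<lambda>z. q (fst z)) W w (\<lambda>z. b (fst z))"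
      by (rule fib_map_from_closed[OF fib_map_compose[OF fib_map_fst b] closedin_level(2)[OF \<theta>(2)]])
    have *: "fib_map (subtopology ?U {z \<in> topspace ?U. ?\<theta> z \<le> 1}) (\<lambda>z. q (fst z)) (band Y q \<tau>) q fst"
      by (rule fib_map_into_closed[OF fib_map_from_closed[OF fstU closedin_level(1)[OF \<theta>(2)]]
            levels(3)]) auto
    show "fib_map (subtopology ?U {z \<in> topspace ?U. ?\<theta> z \<le> 1}) (\<lambda>z. q (fst z)) W w
        (\<lambda>z. H (fst z, 1 - snd z * (1 - ?\<theta> z)))"
    proof (rule fib_map_eval_homotopy[OF H *])
      show "continuous_map (subtopology ?U {z \<in> topspace ?U. ?\<theta> z \<le> 1}) euclideanreal
          (\<lambda>z. 1 - snd z * (1 - ?\<theta> z))"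
        by (intro continuous_map_from_subtopology continuous_intros continuous_map_cyl_snd \<theta>)
    qed (auto intro: mult_le_one)
  qed (use ends in auto)
  define h where "h y = (if \<tau> (q y) \<le> 1 then M (y, 1) else b y)" for y
  have hM: "h y = M (y, 1)" if "y \<in> topspace (sublevel Y q \<tau>)" for y
    using that by (simp add: h_def)
  have hN: "h y = N (y, 1)" if "y \<in> topspace (superlevel Y q \<tau>)" for y
    using that ends[of y] by (auto simp: h_def M_def N_def)
  have "fib_map Y q W w h"
    unfolding h_def
  proof (rule fib_map_cases_le[OF \<tau>])
    show "fib_map (sublevel Y q \<tau>) q W w (\<lambda>y. M (y, 1))"
      by (rule fib_map_eval_homotopy[OF M fib_map_id]) auto
    show "fib_map (subtopology Y {y \<in> topspace Y. 1 \<le> \<tau> (q y)}) q W w b"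
      using b levels(2) by (rule fib_map_from_smaller) auto
  qed (use ends in \<open>auto simp: M_def\<close>)
  moreover have "fib_homotopic (sublevel Y q \<tau>) q W w a h"
    unfolding fib_homotopic_def using M hM ends by (intro exI[of _ M]) (auto simp: M_def)
  moreover have "fib_homotopic (superlevel Y q \<tau>) q W w b h"
    unfolding fib_homotopic_def using N hN ends by (intro exI[of _ N]) (auto simp: N_def)
  ultimately show ?thesis
    using that by blast
qed

text \<open>Homotopy inverses over the two parts are homotopic over the overlap, since both are inverse
  to \<open>f\<close> there; so they glue to a map \<open>g\<close>. The composites \<open>g f\<close> and \<open>f g\<close> are homotopic to the identity
  over each part, which makes them equivalences. The homotopies \<open>g f \<simeq> id\<close> over the two parts
  are never compared, so no coherence between them has to be arranged.\<close>

lemma fib_equiv_union: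
  assumes \<tau>X: "continuous_map X euclideanreal (\<lambda>x. \<tau> (p x))"
    and \<tau>Y: "continuous_map Y euclideanreal (\<lambda>y. \<tau> (q y))"
    and f: "fib_map X p Y q f"
    and above: "fib_equiv_on X p Y q f {b. 0 \<le> \<tau> b}"
    and below: "fib_equiv_on X p Y q f {b. \<tau> b \<le> 1}"
  shows "fib_equiv X p Y q f"
proof -
  note levelsX = closedin_level[OF \<tau>X] and levelsY = closedin_level[OF \<tau>Y]
  obtain g1 where f1: "fib_map (superlevel X p \<tau>) p (superlevel Y q \<tau>) q f"
    and g1: "fib_map (superlevel Y q \<tau>) q (superlevel X p \<tau>) p g1"
    and gf1: "fib_homotopic (superlevel X p \<tau>) p (superlevel X p \<tau>) p (\<lambda>x. g1 (f x)) (\<lambda>x. x)"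
    and fg1: "fib_homotopic (superlevel Y q \<tau>) q (superlevel Y q \<tau>) q (\<lambda>y. f (g1 y)) (\<lambda>y. y)"
    using above by (auto simp: fib_equiv_def)
  obtain g0 where f0: "fib_map (sublevel X p \<tau>) p (sublevel Y q \<tau>) q f"
    and g0: "fib_map (sublevel Y q \<tau>) q (sublevel X p \<tau>) p g0"
    and gf0: "fib_homotopic (sublevel X p \<tau>) p (sublevel X p \<tau>) p (\<lambda>x. g0 (f x)) (\<lambda>x. x)"
    and fg0: "fib_homotopic (sublevel Y q \<tau>) q (sublevel Y q \<tau>) q (\<lambda>y. f (g0 y)) (\<lambda>y. y)"
    using below by (auto simp: fib_equiv_def)
  have g1X: "fib_map (superlevel Y q \<tau>) q X p g1"
    by (rule fib_map_compose[OF g1 fib_map_inclusion[OF levelsX(2)]])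
  have g0X: "fib_map (sublevel Y q \<tau>) q X p g0"
    by (rule fib_map_compose[OF g0 fib_map_inclusion[OF levelsX(1)]])
  let ?L = "{b. \<tau> b \<le> 1}" and ?U = "{b. 0 \<le> \<tau> b}" and ?B = "{b. 0 \<le> \<tau> b \<and> \<tau> b \<le> 1}"
  have BL: "?B \<subseteq> ?L" and BU: "?B \<subseteq> ?U"
    and X: "closedin X {x \<in> topspace X. p x \<in> ?B}" and Y: "closedin Y {y \<in> topspace Y. q y \<in> ?B}"
    using levelsX(3)[of 0 1] levelsY(3)[of 0 1] by auto
  have "fib_homotopic (preimage_space Y q ?B) q (preimage_space X p ?B) p g0 g1"
  proof (rule left_right_inverse_homotopic)
    show "fib_map (preimage_space X p ?B) p (preimage_space Y q ?B) q f"
      using f0 by (intro fib_map_restrict[OF _ BL X Y]) simp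
    show "fib_map (preimage_space Y q ?B) q (preimage_space X p ?B) p g0"
      using g0 by (intro fib_map_restrict[OF _ BL Y X]) simp
    show "fib_map (preimage_space Y q ?B) q (preimage_space X p ?B) p g1"
      using g1 by (intro fib_map_restrict[OF _ BU Y X]) simp
    show "fib_homotopic (preimage_space X p ?B) p (preimage_space X p ?B) p (\<lambda>x. g0 (f x)) (\<lambda>x. x)"
      using gf0 by (intro fib_homotopic_restrict[OF _ BL X X]) simp
    show "fib_homotopic (preimage_space Y q ?B) q (preimage_space Y q ?B) q (\<lambda>y. f (g1 y)) (\<lambda>y. y)"
      using fg1 by (intro fib_homotopic_restrict[OF _ BU Y Y]) simp
  qed
  from fib_homotopic_post[OF this fib_map_inclusion[OF X]]
  have "fib_homotopic (band Y q \<tau>) q X p g0 g1"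
    by simp
  then obtain g where g: "fib_map Y q X p g"
    and g0g: "fib_homotopic (sublevel Y q \<tau>) q X p g0 g"
    and g1g: "fib_homotopic (superlevel Y q \<tau>) q X p g1 g"
    by (rule fib_map_glue_homotopic[OF \<tau>Y g0X g1X])
  have "fib_equiv X p X p (\<lambda>x. g (f x))"
    using \<tau>X fib_map_compose[OF f g]
  proof (rule fib_equiv_locally_homotopic_id)
    show "fib_homotopic (superlevel X p \<tau>) p X p (\<lambda>x. x) (\<lambda>x. g (f x))"
      using fib_homotopic_trans[OF fib_homotopic_sym[OF fib_homotopic_post[OF gf1
            fib_map_inclusion[OF levelsX(2)]]] fib_homotopic_pre[OF g1g f1]] .
    show "fib_homotopic (sublevel X p \<tau>) p X p (\<lambda>x. g (f x)) (\<lambda>x. x)"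
      using fib_homotopic_trans[OF fib_homotopic_sym[OF fib_homotopic_pre[OF g0g f0]]
          fib_homotopic_post[OF gf0 fib_map_inclusion[OF levelsX(1)]]] .
  qed
  moreover have "fib_equiv Y q Y q (\<lambda>y. f (g y))"
    using \<tau>Y fib_map_compose[OF g f]
  proof (rule fib_equiv_locally_homotopic_id)
    show "fib_homotopic (superlevel Y q \<tau>) q Y q (\<lambda>y. y) (\<lambda>y. f (g y))"
      using fib_homotopic_trans[OF fib_homotopic_sym[OF fib_homotopic_post[OF fg1
            fib_map_inclusion[OF levelsY(2)]]] fib_homotopic_post[OF g1g f]] .
    show "fib_homotopic (sublevel Y q \<tau>) q Y q (\<lambda>y. f (g y)) (\<lambda>y. y)"
      using fib_homotopic_trans[OF fib_homotopic_sym[OF fib_homotopic_post[OF g0g f]]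
          fib_homotopic_post[OF fg0 fib_map_inclusion[OF levelsY(1)]]] .
  qed
  ultimately show ?thesis
    by (rule fib_equiv_of_composites[OF f g])
qed

section \<open>Finite families of functions on the base\<close>

lemma fib_equiv_empty:
  assumes "topspace X = {}" "topspace Y = {}"
  shows "fib_equiv X p Y q f"
proof -
  have map: "fib_map V v W w h" if "topspace V = {}" for V v W w h
    using that by (simp add: fib_map_def proper_cont_map_def continuous_map_def)
  have homotopic: "fib_homotopic V v W w h k" if "topspace V = {}" for V v W w h k
    unfolding fib_homotopic_def by (intro exI conjI map) (use that in auto)
  show ?thesis
    unfolding fib_equiv_def by (intro exI conjI map homotopic assms)
qed

text \<open>In the induction step the sum of two terms is at least \<open>c\<close>, so at every point one of them is
  large. The function \<open>\<tau>\<close> is the first term rescaled so that \<open>\<tau> \<ge> 0\<close> means that it is at least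
  \<open>c/3\<close>, and \<open>\<tau> \<le> 1\<close> that it is at most \<open>2 c/3\<close>, which forces the second term to be at least \<open>c/3\<close>.
  Letting \<open>c\<close> vary in the induction pays for the loss.\<close>

lemma fib_equiv_on_sum_ge:
  fixes \<phi> :: "'i \<Rightarrow> 'b \<Rightarrow> real"
  assumes "finite J" and f: "fib_map X p Y q f"
    and "\<And>j. j \<in> J \<Longrightarrow> continuous_map X euclideanreal (\<lambda>x. \<phi> j (p x))"
    and "\<And>j. j \<in> J \<Longrightarrow> continuous_map Y euclideanreal (\<lambda>y. \<phi> j (q y))"
    and "\<And>j c. j \<in> J \<Longrightarrow> c > 0 \<Longrightarrow> fib_equiv_on X p Y q f {b. c \<le> \<phi> j b}"
    and "c > 0"
  shows "fib_equiv_on X p Y q f {b. c \<le> (\<Sum>j\<in>J. \<phi> j b)}"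
  using assms(1,3-)
proof (induction J arbitrary: c rule: finite_induct)
  case empty
  then show ?case
    by (intro fib_equiv_empty) auto
next
  case (insert j J)
  let ?s = "\<lambda>b. \<Sum>i\<in>J. \<phi> i b"
  let ?S = "{b. c \<le> (\<Sum>i\<in>insert j J. \<phi> i b)}"
  define \<tau> where "\<tau> b = 3 * \<phi> j b / c - 1" for b
  have S: "?S = {b. c \<le> \<phi> j b + ?s b}"
    using insert.hyps by simp
  have contX: "continuous_map X euclideanreal (\<lambda>x. \<phi> j (p x))"
      "continuous_map X euclideanreal (\<lambda>x. ?s (p x))"
    and contY: "continuous_map Y euclideanreal (\<lambda>y. \<phi> j (q y))"
      "continuous_map Y euclideanreal (\<lambda>y. ?s (q y))"
    using insert by (auto intro!: continuous_map_sum)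
  have \<tau>X: "continuous_map X euclideanreal (\<lambda>x. \<tau> (p x))"
    and \<tau>Y: "continuous_map Y euclideanreal (\<lambda>y. \<tau> (q y))"
    unfolding \<tau>_def using \<open>c > 0\<close> by (auto intro!: continuous_intros contX contY)
  have SX: "closedin X {x \<in> topspace X. p x \<in> ?S}"
    unfolding S using closedin_level(2)[OF continuous_map_add[OF contX], of c] by simp
  have SY: "closedin Y {y \<in> topspace Y. q y \<in> ?S}"
    unfolding S using closedin_level(2)[OF continuous_map_add[OF contY], of c] by simp
  have "fib_equiv (preimage_space X p ?S) p (preimage_space Y q ?S) q f"
  proof (rule fib_equiv_union)
    show "continuous_map (preimage_space X p ?S) euclideanreal (\<lambda>x. \<tau> (p x))"
      "continuous_map (preimage_space Y q ?S) euclideanreal (\<lambda>y. \<tau> (q y))"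
      using \<tau>X \<tau>Y by (auto intro: continuous_map_from_subtopology)
    show "fib_map (preimage_space X p ?S) p (preimage_space Y q ?S) q f"
      using f SX SY by (rule fib_map_preimage)
    have *: "closedin X {x \<in> topspace X. p x \<in> ?S \<inter> R}"
      if "closedin X {x \<in> topspace X. p x \<in> R}" for R
      using closedin_Int[OF SX that] by (simp add: Int_def conj_ac cong: conj_cong)
    have **: "closedin Y {y \<in> topspace Y. q y \<in> ?S \<inter> R}"
      if "closedin Y {y \<in> topspace Y. q y \<in> R}" for R
      using closedin_Int[OF SY that] by (simp add: Int_def conj_ac cong: conj_cong)
    have "fib_equiv_on X p Y q f (?S \<inter> {b. 0 \<le> \<tau> b})"
    proof (rule fib_equiv_on_subset)
      show "fib_equiv_on X p Y q f {b. c/3 \<le> \<phi> j b}"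
        by (rule insert.prems(3)) (use \<open>c > 0\<close> in auto)
      show "?S \<inter> {b. 0 \<le> \<tau> b} \<subseteq> {b. c/3 \<le> \<phi> j b}"
        using \<open>c > 0\<close> by (auto simp: \<tau>_def field_simps)
    qed (rule * **, use closedin_level(2)[OF \<tau>X, of 0] closedin_level(2)[OF \<tau>Y, of 0] in simp)+
    then show "fib_equiv_on (preimage_space X p ?S) p (preimage_space Y q ?S) q f {b. 0 \<le> \<tau> b}"
      unfolding preimage_space_preimage_space .
    have "fib_equiv_on X p Y q f (?S \<inter> {b. \<tau> b \<le> 1})"
    proof (rule fib_equiv_on_subset)
      show "fib_equiv_on X p Y q f {b. c/3 \<le> ?s b}"
        using insert.prems by (intro insert.IH) auto
      show "?S \<inter> {b. \<tau> b \<le> 1} \<subseteq> {b. c/3 \<le> ?s b}"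
        unfolding S using \<open>c > 0\<close> by (auto simp: \<tau>_def field_simps)
    qed (rule * **, use closedin_level(1)[OF \<tau>X, of 1] closedin_level(1)[OF \<tau>Y, of 1] in simp)+
    then show "fib_equiv_on (preimage_space X p ?S) p (preimage_space Y q ?S) q f {b. \<tau> b \<le> 1}"
      unfolding preimage_space_preimage_space .
  qed
  then show ?case .
qed

section \<open>p-numerable coverings\<close>

text \<open>This is where the point at infinity matters: applied to the compactification of the base, it
  reduces a p-numerable covering to finitely many sets.\<close>

lemma finite_partition_of_unity_compact:
  assumes pou: "locally_finite_partition_of_unity Z \<Gamma> \<pi>" and Z: "compact_space Z"
  shows "finite {\<gamma> \<in> \<Gamma>. \<exists>z \<in> topspace Z. \<pi> \<gamma> z \<noteq> 0}"
proof -
  let ?fin = "\<lambda>W. finite {\<gamma> \<in> \<Gamma>. \<exists>w \<in> W. \<pi> \<gamma> w \<noteq> 0}"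
  have "topspace Z \<subseteq> \<Union>{W. openin Z W \<and> ?fin W}"
    using pou unfolding locally_finite_partition_of_unity_def by blast
  then obtain \<W> where \<W>: "finite \<W>" "\<W> \<subseteq> {W. openin Z W \<and> ?fin W}" "topspace Z \<subseteq> \<Union>\<W>"
    using Z unfolding compact_space_alt
    by (metis (mono_tags, lifting) mem_Collect_eq)
  then have "finite (\<Union>W\<in>\<W>. {\<gamma> \<in> \<Gamma>. \<exists>w \<in> W. \<pi> \<gamma> w \<noteq> 0})"
    by auto
  then show ?thesis
    by (rule finite_subset[rotated]) (use \<W>(3) in blast)
qed

lemma proper_map_over_iff:
  "proper_map_over B X p Y q f \<longleftrightarrow> proper_cont_map X B p \<and> proper_cont_map Y B q \<and> fib_map X p Y q f"
  by (auto simp: proper_map_over_def fib_map_def)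

text \<open>The two ends of a proper homotopy are automatically proper: they are its compositions with
  the closed embeddings of the ends of the cylinder.\<close>

lemma properly_homotopic_over_iff:
  "properly_homotopic_over B X p Y q f g \<longleftrightarrow>
     proper_cont_map X B p \<and> proper_cont_map Y B q \<and> fib_homotopic X p Y q f g"
proof -
  have "properly_homotopic_over B X p Y q f g \<longleftrightarrow> proper_cont_map X B p \<and> proper_cont_map Y B q \<and>
      fib_map X p Y q f \<and> fib_map X p Y q g \<and> fib_homotopic X p Y q f g"
    unfolding properly_homotopic_over_def proper_map_over_iff fib_homotopic_def fib_map_def by auto
  then show ?thesis
    using fib_homotopic_endpoint by blast
qed

lemma proper_homotopy_equivalence_over_iff:
  "proper_homotopy_equivalence_over B X p Y q f \<longleftrightarrow>
     proper_cont_map X B p \<and> proper_cont_map Y B q \<and> fib_equiv X p Y q f"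
  unfolding proper_homotopy_equivalence_over_def fib_equiv_def proper_map_over_iff
    properly_homotopic_over_iff
  by (auto simp: o_def id_def)

theorem theorem25:
  fixes B :: "'b topology" and X :: "'x topology" and Y :: "'y topology"
    and p :: "'x \<Rightarrow> 'b" and q :: "'y \<Rightarrow> 'b" and f :: "'x \<Rightarrow> 'y"
    and A :: "'a set" and C :: "'a \<Rightarrow> 'b set"
  assumes "proper_cont_map X B p"
    and "proper_cont_map Y B q"
    and "proper_cont_map X Y f"
    and "\<forall>x \<in> topspace X. q (f x) = p x"
    and "p_numerable_covering TYPE('i) B A C"
    and "\<forall>\<alpha> \<in> A. closedin B (C \<alpha>)"
    and "\<forall>\<alpha> \<in> A. proper_homotopy_equivalence_over (subtopology B (C \<alpha>))
           (preimage_space X p (C \<alpha>)) p (preimage_space Y q (C \<alpha>)) q f"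
  shows "proper_homotopy_equivalence_over B X p Y q f"
proof -
  let ?Bp = "Alexandroff_compactification B"
  obtain \<Gamma> :: "'i set" and \<pi> where pou: "locally_finite_partition_of_unity ?Bp \<Gamma> \<pi>"
    and refine: "\<And>\<gamma>. \<gamma> \<in> \<Gamma> \<Longrightarrow>
      \<exists>\<alpha> \<in> A. {z \<in> topspace ?Bp. \<pi> \<gamma> z \<in> {0<..1}} \<subseteq> insert None (Some ` C \<alpha>)"
    using assms(5) by (auto simp: p_numerable_covering_def numerable_covering_def)
  define J where "J = {\<gamma> \<in> \<Gamma>. \<exists>z \<in> topspace ?Bp. \<pi> \<gamma> z \<noteq> 0}"
  have finJ: "finite J"
    unfolding J_def using pou by (rule finite_partition_of_unity_compact) simp
  (* The value 0 off the space keeps the sets {b. c \<le> \<phi> \<gamma> b} inside the members of the covering. *)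
  define \<phi> where "\<phi> \<gamma> b = (if b \<in> topspace B then \<pi> \<gamma> (Some b) else 0)" for \<gamma> b
  have \<phi>_cont: "continuous_map V euclideanreal (\<lambda>v. \<phi> \<gamma> (r v))"
    if r: "proper_cont_map V B r" and \<gamma>: "\<gamma> \<in> J" for V and r :: "'v \<Rightarrow> 'b" and \<gamma>
  proof (rule continuous_map_eq)
    have "continuous_map ?Bp euclideanreal (\<pi> \<gamma>)"
      using pou \<gamma> by (auto simp: locally_finite_partition_of_unity_def J_def continuous_map_in_subtopology)
    then show "continuous_map V euclideanreal (\<pi> \<gamma> \<circ> (Some \<circ> r))"
      using proper_cont_map_continuous[OF r]
      by (intro continuous_map_compose[of V ?Bp] continuous_map_compose[of V B] continuous_map_Some)
    show "(\<pi> \<gamma> \<circ> (Some \<circ> r)) v = \<phi> \<gamma> (r v)" if "v \<in> topspace V" for v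
      using continuous_map_funspace[OF proper_cont_map_continuous[OF r]] that
      by (auto simp: \<phi>_def Pi_iff)
  qed
  have sum1: "(\<Sum>\<gamma>\<in>J. \<phi> \<gamma> b) = 1" if b: "b \<in> topspace B" for b
  proof -
    have "(\<Sum>\<gamma>\<in>J. \<phi> \<gamma> b) = (\<Sum>\<gamma> | \<gamma> \<in> \<Gamma> \<and> \<pi> \<gamma> (Some b) \<noteq> 0. \<pi> \<gamma> (Some b))"
      using finJ b by (intro sum.mono_neutral_cong_right) (auto simp: J_def \<phi>_def)
    also have "\<dots> = 1"
      using pou b by (simp add: locally_finite_partition_of_unity_def)
    finally show ?thesis .
  qed
  have f: "fib_map X p Y q f"
    using assms by (simp add: fib_map_def)
  have "fib_equiv_on X p Y q f {b. 1 \<le> (\<Sum>\<gamma>\<in>J. \<phi> \<gamma> b)}"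
  proof (rule fib_equiv_on_sum_ge[OF finJ f])
    fix \<gamma> and c :: real assume \<gamma>: "\<gamma> \<in> J" and c: "c > 0"
    obtain \<alpha> where \<alpha>: "\<alpha> \<in> A" "{z \<in> topspace ?Bp. \<pi> \<gamma> z \<in> {0<..1}} \<subseteq> insert None (Some ` C \<alpha>)"
      using refine[of \<gamma>] \<gamma> unfolding J_def by blast
    show "fib_equiv_on X p Y q f {b. c \<le> \<phi> \<gamma> b}"
    proof (rule fib_equiv_on_subset)
      show "fib_equiv_on X p Y q f (C \<alpha>)"
        using assms(7) \<alpha>(1) by (simp add: proper_homotopy_equivalence_over_iff)
      have "continuous_map ?Bp unit_interval (\<pi> \<gamma>)"
        using pou \<gamma> by (simp add: locally_finite_partition_of_unity_def J_def)
      then have \<pi>_le: "\<pi> \<gamma> z \<le> 1" if "z \<in> topspace ?Bp" for z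
        using continuous_map_funspace[of ?Bp unit_interval "\<pi> \<gamma>"] that by (auto simp: Pi_iff)
      show "{b. c \<le> \<phi> \<gamma> b} \<subseteq> C \<alpha>"
      proof
        fix b assume "b \<in> {b. c \<le> \<phi> \<gamma> b}"
        then have "b \<in> topspace B" "c \<le> \<pi> \<gamma> (Some b)"
          using c by (auto simp: \<phi>_def split: if_splits)
        then have "Some b \<in> {z \<in> topspace ?Bp. \<pi> \<gamma> z \<in> {0<..1}}"
          using c \<pi>_le[of "Some b"] by simp
        with \<alpha>(2) have "Some b \<in> insert None (Some ` C \<alpha>)"
          by (rule subsetD)
        then show "b \<in> C \<alpha>"
          by auto
      qed
    qed (use closedin_level(2)[OF \<phi>_cont[OF assms(1) \<gamma>], of c]
        closedin_level(2)[OF \<phi>_cont[OF assms(2) \<gamma>], of c] in simp_all)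
  qed (auto intro: \<phi>_cont assms(1,2))
  moreover have whole: "preimage_space V r {b. 1 \<le> (\<Sum>\<gamma>\<in>J. \<phi> \<gamma> b)} = V"
    if "proper_cont_map V B r" for V and r :: "'v \<Rightarrow> 'b"
  proof -
    have "{v \<in> topspace V. r v \<in> {b. 1 \<le> (\<Sum>\<gamma>\<in>J. \<phi> \<gamma> b)}} = topspace V"
      using continuous_map_funspace[OF proper_cont_map_continuous[OF that]] sum1
      by (auto simp: Pi_iff)
    then show ?thesis
      by simp
  qed
  ultimately have "fib_equiv X p Y q f"
    unfolding whole[OF assms(1)] whole[OF assms(2)] by simp
  then show ?thesis
    using assms(1,2) by (simp add: proper_homotopy_equivalence_over_iff)
qed

end
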